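(* Let $\mathcal{X}$ be a $d$-class symmetric association scheme with primitive idempotents $\{E_i\}_{i=0}^d$ (where $E_0$ is the trivial primitive idempotent). Let $B$ and $C$ be adjacency matrices of $\mathcal{X}$ with $B$ nontrivial. For $0\le i\le d$ let $\theta_i$ denote the eigenvalue of $B$ for $E_i$. Then the following are equivalent. (i) $\mathcal{X}$ is $P$-polynomial relative to $B$, and $C$ is the last adjacency matrix in this $P$-polynomial structure. (ii) $\{\theta_i\}_{i=0}^d$ are mutually distinct, and for $0\le i\le d$ the dual eigenvalue of $E_i$ for $C$ is $$\frac{(\theta_0-\theta_1)(\theta_0-\theta_2)\cdots(\theta_0-\theta_d)}{(\theta_i-\theta_0)\cdots(\theta_i-\theta_{i-1})(\theta_i-\theta_{i+1})\cdots(\theta_i-\theta_d)}.$$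
   Context: A $d$-class symmetric association scheme is a pair $\mathcal{X}=(X,\{R_i\}_{i=0}^d)$ where $X$ is a finite nonempty set and $R_0,\dots,R_d$ are nonempty subsets of $X\times X$ such that: $R_0=\{(x,x)\mid x\in X\}$; $X\times X$ is the disjoint union of $R_0,\ldots,R_d$; each $R_i$ is symmetric ($(x,y)\in R_i$ iff $(y,x)\in R_i$); and there exist integers $p^h_{ij}$ $(0\le h,i,j\le d)$, called intersection numbers, such that for every $(x,y)\in R_h$, $p^h_{ij}=|\{z\in X\mid (x,z)\in R_i,\ (z,y)\in R_j\}|$. The adjacency matrices are the real $X\times X$ matrices $A_0,\dots,A_d$ with $(A_i)_{x,y}=1$ if $(x,y)\in R_i$ and $0$ otherwise; $A_0=I$ is the trivial one. They form a basis for a commutative algebra $M$ (the Bose-Mesner algebra). $M$ has a second basis $\{E_i\}_{i=0}^d$, the primitive idempotents, with $E_0=|X|^{-1}J$ ($J$ the all-ones matrix; $E_0$ is called trivial), $I=\sum_i E_i$, $E_i^t=E_i$, $E_iE_j=\delta_{i,j}E_i$. Define $P,Q\in\mathrm{Mat}_{d+1}(\mathbb{R})$ by $A_j=\sum_{i=0}^d P_{ij}E_i$ and $E_j=|X|^{-1}\sum_{i=0}^d Q_{ij}A_i$ $(0\le j\le d)$. Then $P_{ij}$ is called the eigenvalue of $A_j$ for $E_i$, and $Q_{ij}$ is called the dual eigenvalue of $E_j$ for $A_i$. An ordering $\{A_i\}_{i=1}^d$ of the nontrivial adjacency matrices (with intersection numbers indexed accordingly, and $A_0=I$) is $P$-polynomial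 whenever for $0\le i,j\le d$ the intersection number $p^1_{ij}$ is zero if $|i-j|>1$ and nonzero if $|i-j|=1$. For a nontrivial adjacency matrix $A$, $\mathcal{X}$ is $P$-polynomial relative to $A$ whenever there exists a $P$-polynomial ordering $\{A_i\}_{i=1}^d$ of the nontrivial adjacency matrices with $A_1=A$; in this case $A_d$ is called the last adjacency matrix in this $P$-polynomial structure. *)

theory Defs
  imports "HOL-Analysis.Analysis" "HOL-Combinatorics.Permutations"
begin

text \<open>The vertex set is the universe of a finite type.\<close>

locale symmetric_association_scheme =
  fixes d :: nat and R :: "nat \<Rightarrow> ('x::finite \<times> 'x) set"
  assumes nonempty: "\<And>i. i \<le> d \<Longrightarrow> R i \<noteq> {}"
    and diagonal: "R 0 = {(x, y). x = y}"
    and covers: "(\<Union>i\<in>{0..d}. R i) = UNIV"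
    and disjoint: "disjoint_family_on R {0..d}"
    and symmetric: "\<And>i x y. i \<le> d \<Longrightarrow> (x, y) \<in> R i \<longleftrightarrow> (y, x) \<in> R i"
    and regular: "\<exists>p. \<forall>h\<le>d. \<forall>i\<le>d. \<forall>j\<le>d. \<forall>(x, y)\<in>R h.
      card {z. (x, z) \<in> R i \<and> (z, y) \<in> R j} = p h i j"

definition intersection_number ::
    "(nat \<Rightarrow> ('x::finite \<times> 'x) set) \<Rightarrow> nat \<Rightarrow> nat \<Rightarrow> nat \<Rightarrow> nat" where
  "intersection_number R h i j =
    (THE p. \<forall>(x, y)\<in>R h. card {z. (x, z) \<in> R i \<and> (z, y) \<in> R j} = p)"

definition adjacency_matrix :: "('x::finite \<times> 'x) set \<Rightarrow> real^'x^'x" where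
  "adjacency_matrix S = (\<chi> x y. if (x, y) \<in> S then 1 else 0)"

definition adjacency_matrices ::
    "nat \<Rightarrow> (nat \<Rightarrow> ('x::finite \<times> 'x) set) \<Rightarrow> (real^'x^'x) set" where
  "adjacency_matrices d R = (\<lambda>i. adjacency_matrix (R i)) ` {0..d}"

definition nontrivial_adjacency_matrices ::
    "nat \<Rightarrow> (nat \<Rightarrow> ('x::finite \<times> 'x) set) \<Rightarrow> (real^'x^'x) set" where
  "nontrivial_adjacency_matrices d R = (\<lambda>i. adjacency_matrix (R i)) ` {1..d}"

definition bose_mesner_algebra ::
    "nat \<Rightarrow> (nat \<Rightarrow> ('x::finite \<times> 'x) set) \<Rightarrow> (real^'x^'x) set" where
  "bose_mesner_algebra d R = span (adjacency_matrices d R)"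

text \<open>\<open>E 0, \<dots>, E d\<close> enumerates the primitive idempotents, the trivial one first. A basis
  of the Bose-Mesner algebra that consists of mutually orthogonal idempotents is necessarily
  the set of its primitive idempotents, so only the order of \<open>E 1, \<dots>, E d\<close> is free.\<close>

definition primitive_idempotents ::
    "nat \<Rightarrow> (nat \<Rightarrow> ('x::finite \<times> 'x) set) \<Rightarrow> (nat \<Rightarrow> real^'x^'x) \<Rightarrow> bool" where
  "primitive_idempotents d R E \<longleftrightarrow>
    inj_on E {0..d} \<and> independent (E ` {0..d}) \<and>
    span (E ` {0..d}) = bose_mesner_algebra d R \<and>
    E 0 = (1 / real CARD('x)) *\<^sub>R (\<chi> x y. 1) \<and>
    (\<Sum>i=0..d. E i) = mat 1 \<and>
    (\<forall>i\<le>d. transpose (E i) = E i) \<and>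
    (\<forall>i\<le>d. \<forall>j\<le>d. E i ** E j = (if i = j then E i else 0))"

text \<open>The eigenvalue of \<open>A\<close> for \<open>E i\<close> is the coefficient of \<open>E i\<close> when \<open>A\<close> is expanded in
  the basis of primitive idempotents. The dual eigenvalue of \<open>F\<close> for \<open>A\<close> is the coefficient
  of \<open>A\<close> when \<open>|X| F\<close> is expanded in the basis of adjacency matrices. The lemmas
  \<open>eigenvalue_expansion\<close> and \<open>dual_eigenvalue_expansion\<close> below give the equations that
  define the two eigenmatrices.\<close>

definition eigenvalue ::
    "nat \<Rightarrow> (nat \<Rightarrow> real^'x^'x) \<Rightarrow> real^'x^'x \<Rightarrow> nat \<Rightarrow> real" where
  "eigenvalue d E A i = representation (E ` {0..d}) A (E i)"

definition dual_eigenvalue ::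
    "nat \<Rightarrow> (nat \<Rightarrow> ('x::finite \<times> 'x) set) \<Rightarrow> real^'x^'x \<Rightarrow> real^'x^'x \<Rightarrow> real" where
  "dual_eigenvalue d R F A =
    representation (adjacency_matrices d R) (real CARD('x) *\<^sub>R F) A"

text \<open>The ordering of the nontrivial adjacency matrices given by \<open>\<sigma>\<close> has the matrix of
  \<open>R (\<sigma> i)\<close> in position \<open>i\<close>; the relations \<open>R \<circ> \<sigma>\<close> carry the reindexed intersection numbers,
  and \<open>\<sigma>\<close> fixes \<open>0\<close>.\<close>

definition P_polynomial_ordering ::
    "nat \<Rightarrow> (nat \<Rightarrow> ('x::finite \<times> 'x) set) \<Rightarrow> (nat \<Rightarrow> nat) \<Rightarrow> bool" where
  "P_polynomial_ordering d R \<sigma> \<longleftrightarrow>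
    \<sigma> permutes {1..d} \<and>
    (\<forall>i\<le>d. \<forall>j\<le>d.
      (\<bar>int i - int j\<bar> > 1 \<longrightarrow> intersection_number (R \<circ> \<sigma>) 1 i j = 0) \<and>
      (\<bar>int i - int j\<bar> = 1 \<longrightarrow> intersection_number (R \<circ> \<sigma>) 1 i j \<noteq> 0))"

context symmetric_association_scheme
begin

lemma intersection_number_eq:
  assumes "h \<le> d" "i \<le> d" "j \<le> d" "(x, y) \<in> R h"
  shows "card {z. (x, z) \<in> R i \<and> (z, y) \<in> R j} = intersection_number R h i j"
proof -
  obtain p where p: "\<forall>h\<le>d. \<forall>i\<le>d. \<forall>j\<le>d. \<forall>(x, y)\<in>R h.
      card {z. (x, z) \<in> R i \<and> (z, y) \<in> R j} = p h i j"
    using regular by blast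
  have "intersection_number R h i j = p h i j"
    unfolding intersection_number_def
    by (rule the_equality) (use p assms in fastforce)+
  then show ?thesis using p assms by fastforce
qed

lemma relation_unique:
  assumes "i \<le> d" "j \<le> d" "e \<in> R i" "e \<in> R j"
  shows "i = j"
  using disjoint assms unfolding disjoint_family_on_def by fastforce

lemma inj_on_adjacency_matrix: "inj_on (\<lambda>i. adjacency_matrix (R i)) {0..d}"
proof (rule inj_onI)
  fix i j assume ij: "i \<in> {0..d}" "j \<in> {0..d}" "adjacency_matrix (R i) = adjacency_matrix (R j)"
  obtain x y where xy: "(x, y) \<in> R i" using nonempty[of i] ij by auto
  have "adjacency_matrix (R i) $ x $ y = adjacency_matrix (R j) $ x $ y" using ij by simp
  then have "(x, y) \<in> R j" using xy by (simp add: adjacency_matrix_def split: if_splits)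
  then show "i = j" using relation_unique xy ij by auto
qed

lemma independent_adjacency_matrices: "independent (adjacency_matrices d R)"
proof -
  have "u (adjacency_matrix (R j)) = 0"
    if "(\<Sum>A\<in>adjacency_matrices d R. u A *\<^sub>R A) = 0" "j \<in> {0..d}" for u j
  proof -
    obtain x y where xy: "(x, y) \<in> R j" using nonempty[of j] \<open>j \<in> {0..d}\<close> by auto
    have "0 = (\<Sum>i\<in>{0..d}. u (adjacency_matrix (R i)) *\<^sub>R adjacency_matrix (R i)) $ x $ y"
      using that(1) inj_on_adjacency_matrix
      by (simp add: adjacency_matrices_def sum.reindex)
    also have "\<dots> = (\<Sum>i\<in>{0..d}. if i = j then u (adjacency_matrix (R i)) else 0)"
      unfolding sum_component
      by (rule sum.cong) (use relation_unique xy that(2) in \<open>auto simp: adjacency_matrix_def\<close>)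
    finally show ?thesis using that(2) by simp
  qed
  moreover have "finite (adjacency_matrices d R)" by (simp add: adjacency_matrices_def)
  ultimately show ?thesis
    by (auto simp: independent_explicit adjacency_matrices_def)
qed

lemma eigenvalue_expansion:
  assumes "primitive_idempotents d R E" "A \<in> adjacency_matrices d R"
  shows "A = (\<Sum>i=0..d. eigenvalue d E A i *\<^sub>R E i)"
proof -
  have E: "inj_on E {0..d}" "independent (E ` {0..d})" "A \<in> span (E ` {0..d})"
    using assms by (auto simp: primitive_idempotents_def bose_mesner_algebra_def span_base)
  have "(\<Sum>F\<in>E ` {0..d}. representation (E ` {0..d}) A F *\<^sub>R F) = A"
    by (rule real_vector.sum_representation_eq) (use E in auto)
  then show ?thesis using E(1) by (simp add: sum.reindex eigenvalue_def)
qed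

lemma dual_eigenvalue_expansion:
  assumes "primitive_idempotents d R E" "j \<le> d"
  shows "E j = (1 / real CARD('x)) *\<^sub>R
    (\<Sum>i=0..d. dual_eigenvalue d R (E j) (adjacency_matrix (R i)) *\<^sub>R adjacency_matrix (R i))"
proof -
  let ?A = "adjacency_matrices d R"
  have "E j \<in> span ?A"
    using assms span_base[of "E j" "E ` {0..d}"]
    by (auto simp: primitive_idempotents_def bose_mesner_algebra_def)
  then have "(\<Sum>F\<in>?A. representation ?A (real CARD('x) *\<^sub>R E j) F *\<^sub>R F) = real CARD('x) *\<^sub>R E j"
    by (intro real_vector.sum_representation_eq)
      (auto simp: independent_adjacency_matrices span_scale, auto simp: adjacency_matrices_def)
  then have "(\<Sum>i=0..d. dual_eigenvalue d R (E j) (adjacency_matrix (R i)) *\<^sub>R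
      adjacency_matrix (R i)) = real CARD('x) *\<^sub>R E j"
    using inj_on_adjacency_matrix
    by (simp add: dual_eigenvalue_def adjacency_matrices_def sum.reindex)
  then show ?thesis by simp
qed

end

end

theory Submission
  imports Defs "HOL-Computational_Algebra.Polynomial"
begin

text \<open>
  Write \<open>N\<close> for the relation of \<open>B\<close>. The \<open>(x, y)\<close> entry of
  \<open>B\<^sup>m = (\<Sum>i. \<theta> i ^ m *\<^sub>R E i)\<close> counts the \<open>N\<close>-walks of length \<open>m\<close> from \<open>x\<close> to \<open>y\<close>, and for
  \<open>(x, y)\<close> in the relation of \<open>C\<close> it equals \<open>(\<Sum>i. \<theta> i ^ m * Q i) / |X|\<close>, where \<open>Q i\<close> is the dual
  eigenvalue of \<open>E i\<close> for \<open>C\<close>. Both conditions say that the vertices of such a pair are at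
  distance \<open>d\<close> in the graph \<open>N\<close>, that is, that these moments vanish for \<open>m < d\<close> and not for
  \<open>m = d\<close>. Up to a scalar, fixed by \<open>Q 0 = 1\<close>, the weights with this property are
  \<open>1 / (\<Prod>j\<noteq>i. \<theta> i - \<theta> j)\<close>, the coefficients of the divided difference at the nodes \<open>\<theta> i\<close>.
  Conversely, a geodesic of length \<open>d\<close> meets all distances \<open>0, \<dots>, d\<close>, so that each of the \<open>d + 1\<close>
  relations is a distance relation of \<open>N\<close>.
\<close>

section \<open>Leading coefficients as divided differences\<close>

lemma coeff_eq_divided_difference:
  fixes f :: "real poly"
  assumes inj: "inj_on \<theta> {0..d}" and deg: "degree f \<le> d"
  shows "coeff f d = (\<Sum>i=0..d. poly f (\<theta> i) / (\<Prod>j\<in>{0..d} - {i}. \<theta> i - \<theta> j))"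
proof -
  define L where "L i = (\<Prod>j\<in>{0..d} - {i}. [:- \<theta> j, 1:])" for i
  define c where "c i = (\<Prod>j\<in>{0..d} - {i}. \<theta> i - \<theta> j)" for i
  define g where "g = (\<Sum>i=0..d. smult (poly f (\<theta> i) / c i) (L i))"
  have degL: "degree (L i) = d" if "i \<in> {0..d}" for i
    unfolding L_def using that by (subst degree_prod_eq_sum_degree) auto
  have monic: "coeff (L i) d = 1" if "i \<in> {0..d}" for i
  proof -
    have "lead_coeff (L i) = 1"
      unfolding L_def lead_coeff_prod by simp
    then show ?thesis using degL[OF that] by simp
  qed
  have c0: "c i \<noteq> 0" if "i \<in> {0..d}" for i
    unfolding c_def using that inj by (auto simp: inj_on_def)
  have polyL: "poly (L i) (\<theta> k) = (if k = i then c k else 0)" if "k \<in> {0..d}" for i k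
  proof (cases "k = i")
    case False
    then show ?thesis using that by (auto simp: L_def poly_prod)
  qed (simp add: L_def c_def poly_prod)
  \<comment> \<open>\<open>g\<close> is the Lagrange interpolant of \<open>f\<close>: both have
    degree at most \<open>d\<close> and agree at \<open>d + 1\<close> distinct nodes. Each
    \<open>L i\<close> is monic of degree \<open>d\<close>, so comparing coefficients at
    \<open>d\<close> gives the formula.\<close>
  have "f = g"
  proof (rule poly_eqI_degree[of "\<theta> ` {0..d}"])
    fix x assume "x \<in> \<theta> ` {0..d}"
    then obtain k where k: "k \<in> {0..d}" "x = \<theta> k" by auto
    have "poly g x = (\<Sum>i=0..d. if k = i then poly f (\<theta> i) else 0)"
      unfolding g_def poly_sum k(2)
      by (rule sum.cong) (use polyL[OF k(1)] c0 in auto)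
    then show "poly f x = poly g x" using k by simp
  next
    have card: "card (\<theta> ` {0..d}) = Suc d" using inj by (simp add: card_image)
    show "card (\<theta> ` {0..d}) > degree f" using card deg by simp
    have "degree g \<le> d"
      unfolding g_def by (rule degree_sum_le) (auto intro!: order_trans[OF degree_smult_le] simp: degL)
    then show "card (\<theta> ` {0..d}) > degree g" using card by simp
  qed
  then have "coeff f d = coeff g d" by simp
  also have "\<dots> = (\<Sum>i=0..d. poly f (\<theta> i) / c i * coeff (L i) d)"
    by (simp add: g_def coeff_sum)
  also have "\<dots> = (\<Sum>i=0..d. poly f (\<theta> i) / c i)"
    by (rule sum.cong) (simp_all add: monic)
  finally show ?thesis by (simp add: c_def)
qed

section \<open>Triangles of relations and entries of the idempotents\<close>

context symmetric_association_scheme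
begin

lemma relation_exists: "\<exists>i\<le>d. e \<in> R i"
proof -
  have "e \<in> (\<Union>i\<in>{0..d}. R i)" by (simp only: covers UNIV_I)
  then show ?thesis by auto
qed

text \<open>By regularity the count is the same over every pair of \<open>R h\<close>, so one
  triangle anywhere decides.\<close>

lemma intersection_number_neq_0_iff:
  assumes "h \<le> d" "i \<le> d" "j \<le> d"
  shows "intersection_number R h i j \<noteq> 0 \<longleftrightarrow>
    (\<exists>x y z. (x, y) \<in> R h \<and> (x, z) \<in> R i \<and> (z, y) \<in> R j)"
proof -
  obtain u w where uw: "(u, w) \<in> R h" using nonempty[OF assms(1)] by auto
  have eq: "intersection_number R h i j \<noteq> 0 \<longleftrightarrow> (\<exists>z. (x, z) \<in> R i \<and> (z, y) \<in> R j)"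
    if "(x, y) \<in> R h" for x y
    using intersection_number_eq[OF assms that, symmetric] by (auto simp: card_eq_0_iff)
  show ?thesis using eq uw by metis
qed

text \<open>Moves a triangle to another base: the number of apexes depends only on the relation of
  the base pair.\<close>

lemma triangle_over_relation:
  assumes "h \<le> d" "i \<le> d" "j \<le> d"
    and "(x, y) \<in> R h" "(x, z) \<in> R i" "(z, y) \<in> R j" "(u, w) \<in> R h"
  obtains v where "(u, v) \<in> R i" "(v, w) \<in> R j"
proof -
  have "card {z. (x, z) \<in> R i \<and> (z, y) \<in> R j} = card {z. (u, z) \<in> R i \<and> (z, w) \<in> R j}"
    using intersection_number_eq[OF assms(1-3) assms(4)] intersection_number_eq[OF assms(1-3) assms(7)]
    by simp
  moreover have "card {z. (x, z) \<in> R i \<and> (z, y) \<in> R j} \<noteq> 0"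
    using assms(5,6) by (auto simp: card_eq_0_iff)
  ultimately have "{z. (u, z) \<in> R i \<and> (z, w) \<in> R j} \<noteq> {}" by (metis card.empty)
  then show ?thesis using that by blast
qed

text \<open>At a pair of \<open>R j\<close> every other adjacency matrix vanishes, which leaves one
  term of the dual expansion.\<close>

lemma idempotent_entry:
  assumes "primitive_idempotents d R E" "i \<le> d" "j \<le> d" "(x, y) \<in> R j"
  shows "E i $ x $ y = dual_eigenvalue d R (E i) (adjacency_matrix (R j)) / real CARD('x)"
proof -
  let ?q = "\<lambda>k. dual_eigenvalue d R (E i) (adjacency_matrix (R k))"
  have "(\<Sum>k=0..d. ?q k *\<^sub>R adjacency_matrix (R k)) $ x $ y = (\<Sum>k=0..d. if k = j then ?q k else 0)"
    unfolding sum_component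
    by (rule sum.cong) (use relation_unique assms(3,4) in \<open>auto simp: adjacency_matrix_def\<close>)
  then have "(\<Sum>k=0..d. ?q k *\<^sub>R adjacency_matrix (R k)) $ x $ y = ?q j"
    using assms(3) by simp
  then show ?thesis
    by (subst dual_eigenvalue_expansion[OF assms(1,2)]) simp
qed

text \<open>Supplies the normalisation of the weights, which vanishing moments determine only up to
  a scalar.\<close>

lemma dual_eigenvalue_trivial:
  assumes "primitive_idempotents d R E" "j \<le> d"
  shows "dual_eigenvalue d R (E 0) (adjacency_matrix (R j)) = 1"
proof -
  obtain x y where xy: "(x, y) \<in> R j" using nonempty[OF assms(2)] by auto
  have "E 0 $ x $ y = 1 / real CARD('x)" using assms(1) by (simp add: primitive_idempotents_def)
  then show ?thesis using idempotent_entry[OF assms(1) _ assms(2) xy, of 0] by simp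
qed

end

section \<open>Powers of the adjacency matrix and walks\<close>

locale scheme_relation = symmetric_association_scheme d R
  for d :: nat and R :: "nat \<Rightarrow> ('x::finite \<times> 'x) set" +
  fixes E :: "nat \<Rightarrow> real^'x^'x" and b :: nat and \<theta> :: "nat \<Rightarrow> real"
  assumes idempotents: "primitive_idempotents d R E"
    and b: "1 \<le> b" "b \<le> d"
    and theta: "\<And>i. i \<le> d \<Longrightarrow> \<theta> i = eigenvalue d E (adjacency_matrix (R b)) i"
begin

text \<open>The entry of the \<open>m\<close>-th power of B, taken from its spectral decomposition,
  so that it is linear in the idempotents.\<close>

definition power_entry :: "nat \<Rightarrow> 'x \<Rightarrow> 'x \<Rightarrow> real" where
  "power_entry m x y = (\<Sum>i=0..d. \<theta> i ^ m * E i $ x $ y)"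

lemma power_entry_0: "power_entry 0 x y = (if x = y then 1 else 0)"
proof -
  have "(\<Sum>i=0..d. E i) $ x $ y = mat 1 $ x $ y"
    using idempotents by (simp add: primitive_idempotents_def)
  then show ?thesis by (simp add: power_entry_def mat_def)
qed

text \<open>This multiplies two spectral expansions; orthogonality of the idempotents leaves only
  the diagonal terms.\<close>

lemma power_entry_Suc: "power_entry (Suc m) x y = (\<Sum>z | (x, z) \<in> R b. power_entry m z y)"
proof -
  let ?B = "adjacency_matrix (R b)"
  have "?B \<in> adjacency_matrices d R" using b by (auto simp: adjacency_matrices_def)
  then have "?B = (\<Sum>i=0..d. eigenvalue d E ?B i *\<^sub>R E i)"
    by (rule eigenvalue_expansion[OF idempotents])
  also have "\<dots> = (\<Sum>i=0..d. \<theta> i *\<^sub>R E i)"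
    by (rule sum.cong) (auto simp: theta)
  finally have B: "?B $ x $ z = (\<Sum>i=0..d. \<theta> i * E i $ x $ z)" for z
    by (simp only: sum_component vector_scaleR_component real_scaleR_def)
  have orth: "(\<Sum>z\<in>UNIV. E i $ x $ z * E j $ z $ y) = (if i = j then E i $ x $ y else 0)"
    if "i \<le> d" "j \<le> d" for i j
  proof -
    have "(E i ** E j) $ x $ y = (if i = j then E i else 0) $ x $ y"
      using idempotents that by (simp add: primitive_idempotents_def)
    then show ?thesis by (auto simp: matrix_matrix_mult_def)
  qed
  have "(\<Sum>z | (x, z) \<in> R b. power_entry m z y) = (\<Sum>z\<in>UNIV. ?B $ x $ z * power_entry m z y)"
    by (rule sum.mono_neutral_cong_left) (auto simp: adjacency_matrix_def)
  also have "\<dots> = (\<Sum>z\<in>UNIV. \<Sum>i=0..d. \<Sum>j=0..d. \<theta> i * E i $ x $ z * (\<theta> j ^ m * E j $ z $ y))"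
    unfolding B power_entry_def sum_product ..
  also have "\<dots> = (\<Sum>i=0..d. \<Sum>z\<in>UNIV. \<Sum>j=0..d. \<theta> i * E i $ x $ z * (\<theta> j ^ m * E j $ z $ y))"
    by (rule sum.swap)
  also have "\<dots> = (\<Sum>i=0..d. \<Sum>j=0..d. \<Sum>z\<in>UNIV. \<theta> i * E i $ x $ z * (\<theta> j ^ m * E j $ z $ y))"
    by (intro sum.cong refl sum.swap)
  also have "\<dots> = (\<Sum>i=0..d. \<Sum>j=0..d. \<theta> i * \<theta> j ^ m * (\<Sum>z\<in>UNIV. E i $ x $ z * E j $ z $ y))"
    by (simp add: sum_distrib_left mult_ac)
  also have "\<dots> = (\<Sum>i=0..d. \<Sum>j=0..d. if i = j then \<theta> i * \<theta> j ^ m * E i $ x $ y else 0)"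
    by (intro sum.cong refl) (auto simp: orth)
  also have "\<dots> = power_entry (Suc m) x y"
    unfolding power_entry_def by (intro sum.cong refl) simp
  finally show ?thesis by simp
qed

lemma power_entry_nonneg: "power_entry m x y \<ge> 0"
  by (induction m arbitrary: x) (auto simp: power_entry_0 power_entry_Suc sum_nonneg)

text \<open>The entries are nonnegative, so nothing cancels in the recursion: a sum over neighbours
  vanishes only if every term does.\<close>

lemma power_entry_eq_0_iff: "power_entry m x y = 0 \<longleftrightarrow> (x, y) \<notin> R b ^^ m"
proof (induction m arbitrary: x)
  case 0
  then show ?case by (simp add: power_entry_0)
next
  case (Suc m)
  have "power_entry (Suc m) x y = 0 \<longleftrightarrow> (\<forall>z. (x, z) \<in> R b \<longrightarrow> (z, y) \<notin> R b ^^ m)"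
    by (simp add: power_entry_Suc sum_nonneg_eq_0_iff power_entry_nonneg Suc)
  \<comment> \<open>The recursion splits off the first step of a walk, \<open>relpow\<close> the
    last one.\<close>
  then show ?case unfolding relpow.simps(2) relpow_commute[symmetric] by blast
qed

text \<open>Both sides are the entry of f(B), once from the spectrum and once from walk
  counts.\<close>

lemma poly_entry:
  "(\<Sum>i=0..d. poly f (\<theta> i) * E i $ x $ y) = (\<Sum>n\<le>degree f. coeff f n * power_entry n x y)"
proof -
  have "(\<Sum>n\<le>degree f. coeff f n * power_entry n x y) =
      (\<Sum>n\<le>degree f. \<Sum>i=0..d. coeff f n * \<theta> i ^ n * E i $ x $ y)"
    by (simp add: power_entry_def sum_distrib_left mult_ac)
  also have "\<dots> = (\<Sum>i=0..d. \<Sum>n\<le>degree f. coeff f n * \<theta> i ^ n * E i $ x $ y)"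
    by (rule sum.swap)
  finally show ?thesis by (simp add: poly_altdef sum_distrib_right)
qed

lemma power_entry_dual:
  assumes "j \<le> d" "(x, y) \<in> R j"
  shows "power_entry m x y =
    (\<Sum>i=0..d. \<theta> i ^ m * dual_eigenvalue d R (E i) (adjacency_matrix (R j))) / real CARD('x)"
  unfolding power_entry_def sum_divide_distrib
  by (rule sum.cong) (auto simp: idempotent_entry[OF idempotents _ assms])

text \<open>By \<open>power_entry_dual\<close> the walk count depends on the pair only through its
  relation. Distance in the graph is thus a function of the relation.\<close>

lemma walk_cong:
  assumes "j \<le> d" "(x, y) \<in> R j" "(u, w) \<in> R j" "(x, y) \<in> R b ^^ m"
  shows "(u, w) \<in> R b ^^ m"
proof -
  have "power_entry m x y = power_entry m u w"
    using power_entry_dual[OF assms(1) assms(2)] power_entry_dual[OF assms(1) assms(3)] by simp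
  then show ?thesis using assms(4) power_entry_eq_0_iff by metis
qed

lemma walk_sym: "(x, y) \<in> R b ^^ m \<Longrightarrow> (y, x) \<in> R b ^^ m"
proof -
  assume walk: "(x, y) \<in> R b ^^ m"
  obtain j where j: "j \<le> d" "(x, y) \<in> R j" using relation_exists by blast
  then have "(y, x) \<in> R j" using symmetric by blast
  then show ?thesis using walk_cong[OF j _ walk] by blast
qed

section \<open>From a P-polynomial ordering to the dual eigenvalues\<close>

context
  fixes \<sigma> :: "nat \<Rightarrow> nat"
  assumes ordering: "P_polynomial_ordering d R \<sigma>" and sigma_1: "\<sigma> 1 = b"
begin

lemma sigma_permutes: "\<sigma> permutes {1..d}"
  using ordering by (simp add: P_polynomial_ordering_def)

lemma sigma_0: "\<sigma> 0 = 0"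
  using sigma_permutes by (simp add: permutes_not_in)

lemma sigma_le: "\<sigma> i \<le> d \<longleftrightarrow> i \<le> d"
  using permutes_in_image[OF permutes_subset[OF sigma_permutes, of "{0..d}"], of i] by auto

lemma relation_position: "\<exists>j\<le>d. e \<in> R (\<sigma> j)"
  using relation_exists[of e] sigma_le permutes_surj[OF sigma_permutes] by (metis surjD)

lemma intersection_number_ordering:
  assumes "i \<le> d" "j \<le> d"
  shows "\<bar>int i - int j\<bar> > 1 \<Longrightarrow> intersection_number R b (\<sigma> i) (\<sigma> j) = 0"
    and "\<bar>int i - int j\<bar> = 1 \<Longrightarrow> intersection_number R b (\<sigma> i) (\<sigma> j) \<noteq> 0"
proof -
  have "intersection_number (R \<circ> \<sigma>) 1 i j = intersection_number R b (\<sigma> i) (\<sigma> j)"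
    by (simp add: intersection_number_def sigma_1[symmetric])
  then show "\<bar>int i - int j\<bar> > 1 \<Longrightarrow> intersection_number R b (\<sigma> i) (\<sigma> j) = 0"
    and "\<bar>int i - int j\<bar> = 1 \<Longrightarrow> intersection_number R b (\<sigma> i) (\<sigma> j) \<noteq> 0"
    using ordering assms unfolding P_polynomial_ordering_def by metis+
qed

text \<open>With \<open>walk_of_position\<close> this identifies position with distance. A walk
  starts in position 0, and the vanishing intersection numbers let each step change the position by
  at most one.\<close>

lemma position_le_walk_length:
  assumes "(x, y) \<in> R b ^^ m" "i \<le> d" "(x, y) \<in> R (\<sigma> i)"
  shows "i \<le> m"
  using assms
proof (induction m arbitrary: y i)
  case 0
  then have "(x, y) \<in> R 0" by (simp add: diagonal)
  then have "\<sigma> i = 0" using 0 relation_unique[of "\<sigma> i" 0] sigma_le by blast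
  then show ?case using sigma_0 permutes_inj[OF sigma_permutes] by (metis injD order_refl)
next
  case (Suc m)
  from Suc.prems(1) obtain z where z: "(x, z) \<in> R b ^^ m" "(z, y) \<in> R b" by auto
  obtain j where j: "j \<le> d" "(x, z) \<in> R (\<sigma> j)" using relation_position by blast
  have "(z, x) \<in> R (\<sigma> j)" using j symmetric sigma_le by blast
  \<comment> \<open>The triangle has base \<open>(z, y)\<close> in \<open>R b\<close> and apex
    \<open>x\<close>.\<close>
  then have "intersection_number R b (\<sigma> j) (\<sigma> i) \<noteq> 0"
    using z(2) Suc.prems(3)
    by (subst intersection_number_neq_0_iff) (auto simp: b(2) sigma_le j(1) Suc.prems(2))
  then have "\<not> \<bar>int j - int i\<bar> > 1"
    using intersection_number_ordering(1)[OF j(1) Suc.prems(2)] by linarith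
  moreover have "j \<le> m" using Suc.IH z(1) j by blast
  ultimately show ?case by simp
qed

text \<open>A nonzero intersection number at adjacent positions yields some triangle; rebased on
  \<open>(x, y)\<close>, it gives a neighbour of \<open>y\<close> one position closer to
  \<open>x\<close>.\<close>

lemma walk_of_position:
  assumes "m \<le> d" "(x, y) \<in> R (\<sigma> m)"
  shows "(x, y) \<in> R b ^^ m"
  using assms
proof (induction m arbitrary: y)
  case 0
  then show ?case by (simp add: sigma_0 diagonal)
next
  case (Suc m)
  have le: "\<sigma> m \<le> d" "\<sigma> (Suc m) \<le> d" using Suc.prems(1) sigma_le by auto
  have "intersection_number R b (\<sigma> m) (\<sigma> (Suc m)) \<noteq> 0"
    using intersection_number_ordering(2) Suc.prems(1) by simp
  then obtain u w v where t: "(u, w) \<in> R b" "(u, v) \<in> R (\<sigma> m)" "(v, w) \<in> R (\<sigma> (Suc m))"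
    using intersection_number_neq_0_iff[of b "\<sigma> m" "\<sigma> (Suc m)"] b le by blast
  have "(v, u) \<in> R (\<sigma> m)" using t(2) symmetric le by blast
  then obtain z where "(x, z) \<in> R (\<sigma> m)" "(z, y) \<in> R b"
    using triangle_over_relation[OF le(2) le(1) b(2) t(3) _ t(1) Suc.prems(2)] by blast
  then show ?case using Suc by auto
qed

text \<open>With only m \<le> d distinct eigenvalues, a monic polynomial of degree m would
  annihilate B. At a pair at distance m all lower powers vanish but the m-th does not, a
  contradiction.\<close>

lemma inj_theta: "inj_on \<theta> {0..d}"
proof (rule ccontr)
  assume "\<not> inj_on \<theta> {0..d}"
  then have less: "card (\<theta> ` {0..d}) < card {0..d}"
    using card_image_le[of "{0..d}" \<theta>] eq_card_imp_inj_on[of "{0..d}" \<theta>] by fastforce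
  define f where "f = (\<Prod>t\<in>\<theta> ` {0..d}. [:- t, 1:])"
  define m where "m = card (\<theta> ` {0..d})"
  have m: "m \<le> d" using less by (simp add: m_def)
  have deg: "degree f = m"
    unfolding f_def m_def by (subst degree_prod_eq_sum_degree) auto
  have monic: "lead_coeff f = 1"
    unfolding f_def lead_coeff_prod by simp
  obtain x y where xy: "(x, y) \<in> R (\<sigma> m)" using nonempty[of "\<sigma> m"] m sigma_le by auto
  have "poly f (\<theta> i) = 0" if "i \<in> {0..d}" for i
    unfolding f_def poly_prod using that by (intro prod_zero) auto
  then have "0 = (\<Sum>n\<le>degree f. coeff f n * power_entry n x y)"
    by (subst poly_entry[symmetric]) simp
  also have "\<dots> = (\<Sum>n\<le>m. if n = m then power_entry m x y else 0)"
    unfolding deg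
  proof (rule sum.cong[OF refl])
    fix n assume n: "n \<in> {..m}"
    show "coeff f n * power_entry n x y = (if n = m then power_entry m x y else 0)"
    proof (cases "n = m")
      case False
      then have "(x, y) \<notin> R b ^^ n" using position_le_walk_length[OF _ m xy] n by force
      then show ?thesis using False by (simp add: power_entry_eq_0_iff)
    qed (use monic deg in simp)
  qed
  also have "\<dots> = power_entry m x y" by simp
  finally show False using walk_of_position[OF m xy] by (simp add: power_entry_eq_0_iff)
qed

text \<open>For \<open>i\<close> other than 0, apply to B the polynomial of degree
  \<open>d - 1\<close> that vanishes at all eigenvalues except \<theta> 0 and \<theta> i. Its entry
  at distance \<open>d\<close> is 0, which ties \<open>q i\<close> to
  \<open>q 0 = 1\<close>.\<close>

lemma dual_eigenvalue_last:
  assumes i: "i \<le> d"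
  shows "dual_eigenvalue d R (E i) (adjacency_matrix (R (\<sigma> d))) =
    (\<Prod>j\<in>{1..d}. \<theta> 0 - \<theta> j) / (\<Prod>j\<in>{0..d} - {i}. \<theta> i - \<theta> j)"
proof -
  define q where "q k = dual_eigenvalue d R (E k) (adjacency_matrix (R (\<sigma> d)))" for k
  have sd: "\<sigma> d \<le> d" by (simp add: sigma_le)
  have q0: "q 0 = 1" unfolding q_def by (rule dual_eigenvalue_trivial[OF idempotents sd])
  have nz: "(\<Prod>j\<in>A. \<theta> k - \<theta> j) \<noteq> 0" if "k \<le> d" "A \<subseteq> {0..d} - {k}" for k A
    using that inj_theta finite_subset[OF that(2)] by (auto simp: inj_on_def)
  obtain x y where xy: "(x, y) \<in> R (\<sigma> d)" using nonempty[OF sd] by auto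
  have entry: "E k $ x $ y = q k / real CARD('x)" if "k \<le> d" for k
    unfolding q_def by (rule idempotent_entry[OF idempotents that sd xy])
  show ?thesis
  proof (cases "i = 0")
    case True
    have "{0..d} - {0} = {1..d}" by auto
    moreover have "(\<Prod>j\<in>{1..d}. \<theta> 0 - \<theta> j) \<noteq> 0" using nz[of 0 "{1..d}"] by fastforce
    ultimately show ?thesis using q0 True by (simp add: q_def)
  next
    case False
    define A where "A = {1..d} - {i}"
    define f where "f = (\<Prod>j\<in>A. [:- \<theta> j, 1:])"
    have "degree f = card A"
      unfolding f_def by (subst degree_prod_eq_sum_degree) auto
    then have deg: "degree f < d" using i False by (simp add: A_def)
    have val: "poly f t = (\<Prod>j\<in>A. t - \<theta> j)" for t by (simp add: f_def poly_prod)
    have "(\<Sum>k=0..d. poly f (\<theta> k) * E k $ x $ y) = 0"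
      unfolding poly_entry
    proof (rule sum.neutral, rule ballI)
      fix n assume "n \<in> {..degree f}"
      then have "(x, y) \<notin> R b ^^ n" using position_le_walk_length[OF _ order_refl xy] deg by force
      then show "coeff f n * power_entry n x y = 0" by (simp add: power_entry_eq_0_iff)
    qed
    then have "0 = (\<Sum>k=0..d. poly f (\<theta> k) * q k) / real CARD('x)"
      by (simp add: entry sum_divide_distrib)
    moreover have "(\<Sum>k=0..d. poly f (\<theta> k) * q k) = (\<Sum>k\<in>{0, i}. poly f (\<theta> k) * q k)"
      by (rule sum.mono_neutral_right) (use i in \<open>auto simp: val A_def\<close>)
    ultimately have eq: "poly f (\<theta> 0) * 1 + poly f (\<theta> i) * q i = 0"
      using False q0 by simp
    have fi: "poly f (\<theta> i) \<noteq> 0" unfolding val by (rule nz) (use i in \<open>auto simp: A_def\<close>)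
    have ne: "\<theta> i - \<theta> 0 \<noteq> 0" using inj_onD[OF inj_theta, of i 0] i False by auto
    have n: "(\<Prod>j\<in>{1..d}. \<theta> 0 - \<theta> j) = (\<theta> 0 - \<theta> i) * poly f (\<theta> 0)"
      unfolding val A_def using i False by (intro prod.remove) auto
    have "{0..d} - {i} = insert 0 A" "0 \<notin> A" "finite A" using False by (auto simp: A_def)
    then have m: "(\<Prod>j\<in>{0..d} - {i}. \<theta> i - \<theta> j) = (\<theta> i - \<theta> 0) * poly f (\<theta> i)"
      unfolding val by simp
    have "q i = - poly f (\<theta> 0) / poly f (\<theta> i)" using eq fi by (simp add: field_simps)
    \<comment> \<open>The quotient of the two new factors is -1, which absorbs the sign and
      completes both products.\<close>
    also have "\<dots> = ((\<theta> 0 - \<theta> i) * poly f (\<theta> 0)) / ((\<theta> i - \<theta> 0) * poly f (\<theta> i))"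
      using fi ne by (simp add: divide_simps) (simp add: algebra_simps)
    finally show ?thesis unfolding n m q_def .
  qed
qed

end

section \<open>From a geodesic of length d to a P-polynomial ordering\<close>

lemma P_polynomial_if_walk:
  assumes c: "c \<le> d" "(x, y) \<in> R c"
    and walk: "(x, y) \<in> R b ^^ d"
    and minimal: "\<And>m. m < d \<Longrightarrow> (x, y) \<notin> R b ^^ m"
  shows "\<exists>\<sigma>. P_polynomial_ordering d R \<sigma> \<and> \<sigma> 1 = b \<and> \<sigma> d = c"
proof -
  obtain p where p: "p 0 = x" "p d = y" "\<And>i. i < d \<Longrightarrow> (p i, p (Suc i)) \<in> R b"
    using walk unfolding relpow_fun_conv by auto
  have to_start: "(x, p i) \<in> R b ^^ i" if "i \<le> d" for i
    using that p(1,3) unfolding relpow_fun_conv by (intro exI[of _ p]) auto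
  have "(p (d - i), y) \<in> R b ^^ i" if "i \<le> d" for i
    using that p(2,3) unfolding relpow_fun_conv by (intro exI[of _ "\<lambda>k. p (d - i + k)"]) auto
  then have to_end: "(p i, y) \<in> R b ^^ (d - i)" if "i \<le> d" for i
    using that by (metis diff_diff_cancel diff_le_self)
  \<comment> \<open>A shorter walk to \<open>p i\<close>, continued along \<open>p\<close>, would
    reach \<open>y\<close> in fewer than \<open>d\<close> steps.\<close>
  have dist: "i \<le> m" if "i \<le> d" "(x, p i) \<in> R b ^^ m" for i m
  proof (rule ccontr)
    assume "\<not> i \<le> m"
    moreover have "(x, y) \<in> R b ^^ (m + (d - i))"
      using that to_end unfolding relpow_add by blast
    ultimately show False using minimal[of "m + (d - i)"] that(1) by linarith
  qed
  \<comment> \<open>\<open>g i\<close> is the relation between \<open>x\<close> and the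
    \<open>i\<close>-th vertex of the geodesic. Its values above \<open>d\<close> carry no
    meaning.\<close>
  obtain g where g: "\<And>i. g i \<le> d" "\<And>i. (x, p i) \<in> R (g i)"
    using relation_exists[of "(x, p i)" for i] choice[of "\<lambda>i j. j \<le> d \<and> (x, p i) \<in> R j"] by blast
  have g_eqI: "g i = j" if "j \<le> d" "(x, p i) \<in> R j" for i j
    using relation_unique[OF g(1) that(1) g(2) that(2)] .
  have inj: "inj_on g {0..d}"
  proof (rule inj_onI)
    fix i j assume ij: "i \<in> {0..d}" "j \<in> {0..d}" "g i = g j"
    \<comment> \<open>If the relations agree, \<open>p i\<close> and \<open>p j\<close> can be
      reached from \<open>x\<close> by walks of the same lengths, so \<open>dist\<close> applies
      both ways.\<close>
    have "(x, p j) \<in> R b ^^ i" "(x, p i) \<in> R b ^^ j"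
      using walk_cong[OF g(1)[of i] g(2)[of i], of x "p j" i] g(2)[of j]
        walk_cong[OF g(1)[of j] g(2)[of j], of x "p i" j] g(2)[of i] ij to_start by auto
    then show "i = j" using dist[of j i] dist[of i j] ij by simp
  qed
  have g0: "g 0 = 0" by (rule g_eqI) (simp_all add: p(1) diagonal)
  have g1: "g 1 = b" by (rule g_eqI) (use b p(1) p(3)[of 0] in auto)
  have gd: "g d = c" by (rule g_eqI) (use c p in auto)
  have "inj_on g {1..d}" by (rule inj_on_subset[OF inj]) auto
  moreover have "g ` {1..d} \<subseteq> {1..d}"
  proof
    fix k assume "k \<in> g ` {1..d}"
    then obtain i where i: "k = g i" "i \<in> {1..d}" by auto
    then have "g i \<noteq> g 0" using inj_onD[OF inj, of i 0] by auto
    then show "k \<in> {1..d}" using i g0 g(1)[of i] by auto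
  qed
  \<comment> \<open>An injective self-map of a finite set is onto: every nontrivial relation occurs
    along the geodesic.\<close>
  ultimately have bij: "bij_betw g {1..d} {1..d}"
    by (simp add: bij_betw_def endo_inj_surj)
  \<comment> \<open>\<open>permutes\<close> demands the identity outside \<open>{1..d}\<close>,
    which \<open>g\<close> need not satisfy.\<close>
  define \<sigma> where "\<sigma> i = (if i \<in> {1..d} then g i else i)" for i
  have "bij_betw \<sigma> {1..d} {1..d}"
    using bij by (rule bij_betw_cong[THEN iffD1, rotated]) (simp add: \<sigma>_def)
  then have perm: "\<sigma> permutes {1..d}"
    by (rule bij_imp_permutes) (auto simp: \<sigma>_def)
  have \<sigma>: "\<sigma> i = g i" if "i \<le> d" for i
    using that g0 by (cases "i = 0") (auto simp: \<sigma>_def)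
  have position_le: "i \<le> m" if "i \<le> d" "(u, w) \<in> R (g i)" "(u, w) \<in> R b ^^ m" for i u w m
    using dist[OF that(1)] walk_cong[OF g(1) that(2) g(2) that(3)] by blast
  have walk_of: "(u, w) \<in> R b ^^ i" if "i \<le> d" "(u, w) \<in> R (g i)" for i u w
    using walk_cong[OF g(1) g(2) that(2) to_start[OF that(1)]] .
  have num: "intersection_number (R \<circ> \<sigma>) 1 i j = intersection_number R b (g i) (g j)"
    if "i \<le> d" "j \<le> d" for i j
    using that b \<sigma>[of 1] g1 by (simp add: intersection_number_def \<sigma>)
  note triangle = intersection_number_neq_0_iff[OF b(2) g(1) g(1)]
  \<comment> \<open>The triangle inequality: the distances from \<open>z\<close> to the adjacent
    vertices \<open>u\<close> and \<open>w\<close> are \<open>i\<close> and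
    \<open>j\<close>.\<close>
  have far: "intersection_number R b (g i) (g j) = 0"
    if ij: "i \<le> d" "j \<le> d" "\<bar>int i - int j\<bar> > 1" for i j
  proof (rule ccontr)
    assume "intersection_number R b (g i) (g j) \<noteq> 0"
    then obtain u w z where t: "(u, w) \<in> R b" "(u, z) \<in> R (g i)" "(z, w) \<in> R (g j)"
      using triangle by blast
    have "(z, w) \<in> R b ^^ Suc i"
      using walk_sym[OF walk_of[OF ij(1) t(2)]] t(1) by auto
    then have "j \<le> Suc i" using position_le[OF ij(2) t(3)] by blast
    moreover have "(u, z) \<in> R b ^^ Suc j"
      using walk_sym[OF walk_of[OF ij(2) t(3)]] t(1) by (blast intro: relpow_Suc_I2)
    then have "i \<le> Suc j" using position_le[OF ij(1) t(2)] by blast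
    ultimately show False using ij(3) by linarith
  qed
  \<comment> \<open>The witness is the triangle formed by \<open>x\<close> and two consecutive
    vertices of the geodesic.\<close>
  have near: "intersection_number R b (g i) (g j) \<noteq> 0"
    if ij: "i \<le> d" "j \<le> d" "\<bar>int i - int j\<bar> = 1" for i j
  proof -
    have "j = Suc i \<or> i = Suc j" using ij(3) by linarith
    then have "(p i, p j) \<in> R b"
      using p(3)[of i] p(3)[of j] ij symmetric[OF b(2)] by auto
    moreover have "(p i, x) \<in> R (g i)" using g symmetric by blast
    ultimately show ?thesis using triangle g(2)[of j] by blast
  qed
  have "P_polynomial_ordering d R \<sigma>"
    unfolding P_polynomial_ordering_def using perm num far near by simp
  moreover have "\<sigma> 1 = b" "\<sigma> d = c" using \<sigma> b g1 gd by auto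
  ultimately show ?thesis by blast
qed

text \<open>With these weights the \<open>m\<close>-th moment is, up to a nonzero factor, the
  divided difference of t^m, that is, its coefficient at \<open>d\<close>: zero for m < d and one
  for m = d. Hence the pairs of \<open>R c\<close> are at distance \<open>d\<close>.\<close>

lemma P_polynomial_if_dual_eigenvalues:
  assumes inj: "inj_on \<theta> {0..d}" and c: "c \<le> d"
    and dual: "\<And>i. i \<le> d \<Longrightarrow> dual_eigenvalue d R (E i) (adjacency_matrix (R c)) =
      (\<Prod>j\<in>{1..d}. \<theta> 0 - \<theta> j) / (\<Prod>j\<in>{0..d} - {i}. \<theta> i - \<theta> j)"
  shows "\<exists>\<sigma>. P_polynomial_ordering d R \<sigma> \<and> \<sigma> 1 = b \<and> \<sigma> d = c"
proof -
  obtain x y where xy: "(x, y) \<in> R c" using nonempty[OF c] by auto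
  define K where "K = (\<Prod>j\<in>{1..d}. \<theta> 0 - \<theta> j)"
  have K: "K \<noteq> 0" unfolding K_def using inj_onD[OF inj, of 0] by force
  have moment: "power_entry m x y = K * coeff (monom 1 m) d / real CARD('x)" if "m \<le> d" for m
  proof -
    have "power_entry m x y =
        (\<Sum>i=0..d. K * (poly (monom 1 m) (\<theta> i) / (\<Prod>j\<in>{0..d} - {i}. \<theta> i - \<theta> j))) / real CARD('x)"
      unfolding power_entry_dual[OF c xy] K_def
      by (intro arg_cong2[where f = "(/)"] sum.cong refl) (simp add: dual poly_monom)
    then show ?thesis
      using coeff_eq_divided_difference[OF inj, of "monom 1 m"] that
      by (simp add: degree_monom_eq sum_distrib_left)
  qed
  show ?thesis
  proof (rule P_polynomial_if_walk[OF c xy])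
    show "(x, y) \<in> R b ^^ d"
      using moment[of d] K power_entry_eq_0_iff[of d x y] by simp
    show "(x, y) \<notin> R b ^^ m" if "m < d" for m
      using moment[of m] that power_entry_eq_0_iff[of m x y] by simp
  qed
qed

end

theorem theorem1p2:
  fixes d :: nat
    and R :: "nat \<Rightarrow> ('x::finite \<times> 'x) set"
    and E :: "nat \<Rightarrow> real^'x^'x"
    and B C :: "real^'x^'x"
    and \<theta> :: "nat \<Rightarrow> real"
  assumes "symmetric_association_scheme d R"
    and "primitive_idempotents d R E"
    and "B \<in> nontrivial_adjacency_matrices d R"
    and "C \<in> adjacency_matrices d R"
    and "\<And>i. i \<le> d \<Longrightarrow> \<theta> i = eigenvalue d E B i"
  shows
    "(\<exists>\<sigma>. P_polynomial_ordering d R \<sigma> \<and>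
        adjacency_matrix (R (\<sigma> 1)) = B \<and> adjacency_matrix (R (\<sigma> d)) = C)
      \<longleftrightarrow>
     inj_on \<theta> {0..d} \<and>
     (\<forall>i\<le>d. dual_eigenvalue d R (E i) C =
        (\<Prod>j\<in>{1..d}. \<theta> 0 - \<theta> j) / (\<Prod>j\<in>{0..d} - {i}. \<theta> i - \<theta> j))"
    (is "?P \<longleftrightarrow> ?Q")
proof -
  interpret symmetric_association_scheme d R by (rule assms(1))
  obtain b where B: "1 \<le> b" "b \<le> d" "B = adjacency_matrix (R b)"
    using assms(3) by (auto simp: nontrivial_adjacency_matrices_def)
  obtain c where c: "c \<le> d" "C = adjacency_matrix (R c)"
    using assms(4) by (auto simp: adjacency_matrices_def)
  interpret scheme_relation d R E b \<theta>
    by unfold_locales (use assms(2,5) B in auto)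
  show ?thesis
  proof
    assume ?P
    then obtain \<sigma> where \<sigma>: "P_polynomial_ordering d R \<sigma>"
        "adjacency_matrix (R (\<sigma> 1)) = B" "adjacency_matrix (R (\<sigma> d)) = C" by blast
    have "\<sigma> 1 \<in> {1..d}"
      using \<sigma>(1) b permutes_in_image[of \<sigma> "{1..d}" 1] by (auto simp: P_polynomial_ordering_def)
    moreover have "adjacency_matrix (R (\<sigma> 1)) = adjacency_matrix (R b)"
      using \<sigma>(2) B(3) by (rule trans)
    \<comment> \<open>The ordering is given through matrices; distinct indices have distinct
      matrices, so the index is recovered.\<close>
    ultimately have "\<sigma> 1 = b"
      using inj_onD[OF inj_on_adjacency_matrix, of "\<sigma> 1" b] b(1,2) by auto
    then show ?Q using inj_theta[OF \<sigma>(1)] dual_eigenvalue_last[OF \<sigma>(1)] \<sigma>(3) by auto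
  next
    assume ?Q
    then have "\<exists>\<sigma>. P_polynomial_ordering d R \<sigma> \<and> \<sigma> 1 = b \<and> \<sigma> d = c"
      using c by (intro P_polynomial_if_dual_eigenvalues) auto
    then show ?P using B(3) c by blast
  qed
qed

end
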